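(* Let $x$ be a point in the interior of $C_N^D$, and let $y\in \mathbb R^N$. Let $k_0\ge 1/2$ be such that $\sqrt k \cdot x+y$ lies in the interior of $C_N^D$ for all $k\ge k_0$. For $k\ge k_0$ consider the Bessel processes $(X_{t,k})_{t\ge0}$ of type $D_N$ with multiplicity $k$ started from $\sqrt k\cdot x+y$. Then, for all $t>0$, \[\sup_{0\le s\le t,\; k\ge k_0}\|X_{s,k}- \sqrt k\, \phi(s,x) \|<\infty\quad\text{almost surely.}\] In particular, $X_{t,k}/\sqrt k\to \phi(t,x)$ for $k\to\infty$ locally uniformly in $t$ almost surely, and thus locally uniformly in $t$ in probability.
   Context: $N$ is the number of particles, $C_N^D:=\{x\in\mathbb R^N: x_1\ge \ldots\ge x_{N-1}\ge |x_N|\}$, and $\|\cdot\|$ is the Euclidean norm. $(B_t)_{t\ge0}=(B_t^1,\ldots,B_t^N)_{t\ge0}$ is an $N$-dimensional Brownian motion started at $0$. The Bessel process $(X_{t,k})_{t\ge0}$ of type $D_N$ with multiplicity $k$ is the unique strong solution in $C_N^D$, with the given starting point, of \[ dX_{t,k}^i = dB_t^i+ k\sum_{j\ne i} \Bigl(\frac{1}{X_{t,k}^i-X_{t,k}^j} + \frac{1}{X_{t,k}^i+X_{t,k}^j}\Bigr) dt \qquad(i=1,\ldots,N).\] The same Brownian motion is used for all $k\ge k_0$. $\phi(t,x)$ denotes the solution at time $t\ge0$ of the deterministic dynamical system $\frac{d}{dt}x(t)=H(x(t))$ in the interior of $C_N^D$ with $x(0)=x$, where the $i$-th component of $H$ is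 \[H_i(x)=\sum_{j\ne i}\Bigl( \frac{1}{x_i-x_j}+ \frac{1}{x_i+x_j}\Bigr)\qquad(i=1,\ldots,N).\] This solution exists for all $t\ge0$ and stays in the interior of $C_N^D$.
   Formalization: The Bessel processes are taken in versions for which, almost surely, X_{t,k} is continuous in k≥k_0 for every t; each X_{t,k} is determined only up to a null set depending on k, and for arbitrary versions the supremum over all k can be infinite. *)

theory Defs
  imports "HOL-Probability.Probability"
begin

text \<open>
  Vectors of \<open>\<real>\<^sup>N\<close> have type \<open>real ^ 'n\<close> for a finite, linearly ordered index type \<open>'n\<close>,
  which stands for \<open>{1 < \<dots> < N}\<close>; thus the last index \<open>N\<close> is \<^term>\<open>Max (UNIV :: 'n::{finite,linorder} set)\<close>.
\<close>

type_synonym 'n rvec = "(real, 'n) vec"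

definition last_index :: "'n::{finite,linorder}" where
  "last_index = Max UNIV"

definition chamber_D :: "('n::{finite,linorder} rvec) set" where
  "chamber_D = {x. (\<forall>i j. i \<le> j \<and> j < last_index \<longrightarrow> x $ j \<le> x $ i) \<and>
                   (\<forall>i<last_index. \<bar>x $ last_index\<bar> \<le> x $ i)}"

definition drift_D :: "'n::{finite,linorder} rvec \<Rightarrow> 'n rvec" where
  "drift_D x = (\<chi> i. \<Sum>j\<in>UNIV - {i}. 1 / (x $ i - x $ j) + 1 / (x $ i + x $ j))"

definition flow_line_D :: "'n::{finite,linorder} rvec \<Rightarrow> (real \<Rightarrow> 'n rvec) \<Rightarrow> bool" where
  "flow_line_D x f \<longleftrightarrow> f 0 = x \<and>
     (\<forall>t\<ge>0. f t \<in> interior chamber_D \<and>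
            (f has_vector_derivative drift_D (f t)) (at t within {0..}))"

text \<open>
  Standard Brownian motion in \<open>\<real>\<^sup>N\<close> started at 0: all coordinates of all increments over disjoint
  time intervals are jointly independent, so in particular the coordinate processes are independent.
  Processes are indexed by \<^typ>\<open>real\<close>; values at negative times are irrelevant throughout.
\<close>

definition brownian_motion :: "'w measure \<Rightarrow> (real \<Rightarrow> 'w \<Rightarrow> 'n::finite rvec) \<Rightarrow> bool" where
  "brownian_motion M B \<longleftrightarrow>
     prob_space M \<and>
     (\<forall>t\<ge>0. B t \<in> borel_measurable M) \<and>
     (AE \<omega> in M. B 0 \<omega> = 0) \<and>
     (AE \<omega> in M. continuous_on {0..} (\<lambda>t. B t \<omega>)) \<and>
     (\<forall>s t i. 0 \<le> s \<and> s < t \<longrightarrow>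
        distributed M lborel (\<lambda>\<omega>. B t \<omega> $ i - B s \<omega> $ i) (normal_density 0 (sqrt (t - s)))) \<and>
     (\<forall>(\<tau> :: nat \<Rightarrow> real) m. 0 \<le> \<tau> 0 \<and> strict_mono \<tau> \<longrightarrow>
        prob_space.indep_vars M (\<lambda>_. borel)
          (\<lambda>(l, i) \<omega>. B (\<tau> (Suc l)) \<omega> $ i - B (\<tau> l) \<omega> $ i) ({..<m} \<times> UNIV))"

text \<open>The natural filtration of \<open>B\<close>, augmented by all subsets of null sets.\<close>

definition augmented_filtration ::
    "'w measure \<Rightarrow> (real \<Rightarrow> 'w \<Rightarrow> 'b::topological_space) \<Rightarrow> real \<Rightarrow> 'w measure" where
  "augmented_filtration M B t =
     sigma (space M)
       ({B s -` A \<inter> space M | s A. 0 \<le> s \<and> s \<le> t \<and> A \<in> sets borel} \<union> null_sets (completion M))"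

text \<open>
  The noise is additive, so the stochastic differential equation in integral form makes sense path
  by path, for a path \<open>b\<close> of the Brownian motion. As \<open>1 / 0 = 0\<close> in HOL, it is
  required explicitly that the singular drift is defined at almost every time. Whether a path
  touches the boundary of the chamber is not prescribed.
\<close>

definition bessel_path_D ::
    "real \<Rightarrow> 'n::{finite,linorder} rvec \<Rightarrow> (real \<Rightarrow> 'n rvec) \<Rightarrow> (real \<Rightarrow> 'n rvec) \<Rightarrow> bool" where
  "bessel_path_D k x0 b f \<longleftrightarrow>
     continuous_on {0..} f \<and>
     f 0 = x0 \<and>
     (\<forall>t\<ge>0. f t \<in> chamber_D) \<and>
     (AE s in lborel. 0 \<le> s \<longrightarrow> f s \<in> interior chamber_D) \<and>
     (\<forall>t\<ge>0. set_integrable lborel {0..t} (\<lambda>s. drift_D (f s)) \<and>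
            f t = x0 + b t + k *\<^sub>R (LINT s:{0..t}|lborel. drift_D (f s)))"

definition bessel_process_D ::
    "'w measure \<Rightarrow> (real \<Rightarrow> 'w \<Rightarrow> 'n::{finite,linorder} rvec) \<Rightarrow> real \<Rightarrow> 'n rvec \<Rightarrow>
      (real \<Rightarrow> 'w \<Rightarrow> 'n rvec) \<Rightarrow> bool" where
  "bessel_process_D M B k x0 X \<longleftrightarrow>
     (\<forall>t\<ge>0. X t \<in> borel_measurable (augmented_filtration M B t)) \<and>
     (AE \<omega> in M. bessel_path_D k x0 (\<lambda>t. B t \<omega>) (\<lambda>t. X t \<omega>))"

text \<open>
  For each \<open>k\<close>, the process \<open>X k\<close> is determined by the equation only up to a null set that may
  depend on \<open>k\<close>. Almost sure assertions about uncountably many \<open>k\<close> simultaneously therefore need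
  a choice of versions; the usual one is continuity in the parameter \<open>k\<close>. It holds automatically
  if the equations for all \<open>k \<ge> k0\<close> hold outside a common null set, since the drift is
  monotone: \<open>\<langle>drift_D u - drift_D v, u - v\<rangle> \<le> 0\<close> for \<open>u\<close>, \<open>v\<close> in the interior of the chamber.
\<close>

definition bessel_family_D ::
    "'w measure \<Rightarrow> (real \<Rightarrow> 'w \<Rightarrow> 'n::{finite,linorder} rvec) \<Rightarrow> real \<Rightarrow> (real \<Rightarrow> 'n rvec) \<Rightarrow>
      (real \<Rightarrow> real \<Rightarrow> 'w \<Rightarrow> 'n rvec) \<Rightarrow> bool" where
  "bessel_family_D M B k0 x0 X \<longleftrightarrow>
     (\<forall>k\<ge>k0. bessel_process_D M B k (x0 k) (X k)) \<and>
     (AE \<omega> in M. \<forall>t\<ge>0. continuous_on {k0..} (\<lambda>k. X k t \<omega>))"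

end

theory Submission
  imports Defs
begin

text \<open>
  Path by path, compare \<open>X\<close> with \<open>g = (sqrt k + l) \<phi> + B\<close>, where \<open>l\<close> is so large that \<open>l \<phi>\<close> dominates
  \<open>B\<close> on the given time interval. Then \<open>g\<close> stays in the open chamber, and \<open>w = X - g\<close> is absolutely
  continuous, since the noise cancels. As \<open>H\<close> is monotone, \<open>\<langle>w', w\<rangle>\<close> is at most
  \<open>\<langle>k H(g) - (sqrt k + l) H(\<phi>), w\<rangle>\<close>; as \<open>H\<close> is homogeneous of degree \<open>-1\<close>, the first
  factor is bounded uniformly in \<open>k\<close>. Hence \<open>w\<close> is bounded uniformly in \<open>k\<close>, for a countable
  dense set of \<open>k\<close> first and then for all \<open>k\<close> by continuity.
\<close>

section \<open>The open chamber and its pairwise inequalities\<close>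

text \<open>Stated for all pairs rather than for neighbouring coordinates, so that each denominator
  of the drift gets its sign directly. The last coordinate may have either sign.\<close>

definition open_chamber_D :: "('n::{finite,linorder} rvec) set" where
  "open_chamber_D = {x. \<forall>i j. i < j \<longrightarrow> \<bar>x $ j\<bar> < x $ i}"

lemma open_chamber_D_gaps:
  assumes "x \<in> open_chamber_D" and "i < j"
  shows "0 < x $ i - x $ j" and "0 < x $ i + x $ j"
proof -
  have "\<bar>x $ j\<bar> < x $ i"
    using assms by (auto simp: open_chamber_D_def)
  then show "0 < x $ i - x $ j" and "0 < x $ i + x $ j"
    by linarith+
qed

text \<open>A coordinate before the last one dominates the absolute value of the last one, hence is
  nonnegative and equals its own absolute value.\<close>

lemma chamber_D_abs_le:
  assumes x: "x \<in> chamber_D" and "i < j"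
  shows "\<bar>x $ j\<bar> \<le> x $ i"
proof (cases "j = last_index")
  case True
  with assms show ?thesis
    by (auto simp: chamber_D_def)
next
  case False
  then have j: "j < last_index"
    unfolding last_index_def by (simp add: order.strict_iff_order)
  with x \<open>i < j\<close> have "x $ j \<le> x $ i" "\<bar>x $ last_index\<bar> \<le> x $ j"
    by (auto simp: chamber_D_def)
  then show ?thesis
    by linarith
qed

text \<open>At an interior point, coordinate \<open>i\<close> can be lowered slightly without
  leaving the chamber; the weak inequality at the lowered point is a strict one at the original
  point.\<close>

lemma interior_chamber_D_subset: "interior chamber_D \<subseteq> open_chamber_D"
proof
  fix x :: "'n::{finite,linorder} rvec"
  assume "x \<in> interior chamber_D"
  then obtain e where e: "e > 0" "ball x e \<subseteq> chamber_D"
    by (auto simp: mem_interior)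
  have "\<bar>x $ j\<bar> < x $ i" if "i < j" for i j
  proof -
    have "x - (e / 2) *\<^sub>R axis i 1 \<in> ball x e"
      using e(1) by (simp add: dist_norm)
    with e(2) have "x - (e / 2) *\<^sub>R axis i 1 \<in> chamber_D"
      by blast
    from chamber_D_abs_le[OF this \<open>i < j\<close>] e(1) less_imp_neq[OF \<open>i < j\<close>] show ?thesis
      by (auto simp: axis_def)
  qed
  then show "x \<in> open_chamber_D"
    by (simp add: open_chamber_D_def)
qed

section \<open>Monotonicity of the drift\<close>

lemma inverse_diff_mult_diff_le_0:
  fixes p q :: real
  assumes "0 < p" and "0 < q"
  shows "(1 / p - 1 / q) * (p - q) \<le> 0"
proof -
  have "(1 / p - 1 / q) * (p - q) = - ((p - q)\<^sup>2 / (p * q))"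
    using assms by (simp add: field_simps power2_eq_square)
  then show ?thesis
    using assms by simp
qed

text \<open>On the open chamber the drift is the gradient of a concave function, the sum of log(x_i
  - x_j) + log(x_i + x_j) over i < j. The proof symmetrises the double sum and reduces each pair to
  the monotonicity of 1/p.\<close>

lemma drift_D_monotone:
  assumes u: "u \<in> open_chamber_D" and v: "v \<in> open_chamber_D"
  shows "(drift_D u - drift_D v) \<bullet> (u - v) \<le> 0"
proof -
  \<comment> \<open>The zero diagonal lets both sums run over the whole index type, so that they can
    be swapped.\<close>
  define q where "q i j = (if i = j then 0 else (1 / (u $ i - u $ j) - 1 / (v $ i - v $ j)) +
    (1 / (u $ i + u $ j) - 1 / (v $ i + v $ j)))" for i j
  define d where "d = u - v"
  have "(drift_D u - drift_D v) $ i = (\<Sum>j\<in>UNIV. q i j)" for i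
  proof -
    have "(\<Sum>j\<in>UNIV. q i j) = (\<Sum>j\<in>UNIV - {i}. q i j)"
      by (rule sum.mono_neutral_right) (auto simp: q_def)
    also have "\<dots> = (\<Sum>j\<in>UNIV - {i}. (1 / (u $ i - u $ j) + 1 / (u $ i + u $ j)) -
        (1 / (v $ i - v $ j) + 1 / (v $ i + v $ j)))"
      by (rule sum.cong) (auto simp: q_def)
    finally show ?thesis
      by (simp add: drift_D_def sum_subtractf)
  qed
  then have "(drift_D u - drift_D v) \<bullet> d = (\<Sum>i\<in>UNIV. \<Sum>j\<in>UNIV. q i j * d $ i)"
    by (simp add: inner_vec_def sum_distrib_right)
  moreover have "(\<Sum>i\<in>UNIV. \<Sum>j\<in>UNIV. q i j * d $ i) = (\<Sum>j\<in>UNIV. \<Sum>i\<in>UNIV. q i j * d $ i)"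
    by (rule sum.swap)
  \<comment> \<open>Adding the swapped copy pairs the terms for (i,j) and (j,i); the sign is visible
    only for such a pair.\<close>
  ultimately have "2 * ((drift_D u - drift_D v) \<bullet> d) =
      (\<Sum>i\<in>UNIV. \<Sum>j\<in>UNIV. q i j * d $ i) + (\<Sum>j\<in>UNIV. \<Sum>i\<in>UNIV. q i j * d $ i)"
    by linarith
  also have "\<dots> = (\<Sum>i\<in>UNIV. \<Sum>j\<in>UNIV. q i j * d $ i + q j i * d $ j)"
    by (simp add: sum.distrib)
  also have "\<dots> \<le> 0"
  proof (intro sum_nonpos)
    have *: "q i j * d $ i + q j i * d $ j \<le> 0" if "i < j" for i j
    proof -
      note pos = open_chamber_D_gaps[OF u that] open_chamber_D_gaps[OF v that]
      \<comment> \<open>Exchanging \<open>i\<close> and \<open>j\<close> flips the sign of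
        \<open>a\<close> and keeps \<open>e\<close>, so in the paired term \<open>a\<close>
        multiplies the difference of the coordinates of \<open>d\<close>, and \<open>e\<close> their
        sum.\<close>
      define a where "a = 1 / (u $ i - u $ j) - 1 / (v $ i - v $ j)"
      define e where "e = 1 / (u $ i + u $ j) - 1 / (v $ i + v $ j)"
      have "q i j = a + e"
        using less_imp_neq[OF that] by (simp add: q_def a_def e_def)
      moreover have "1 / (u $ j - u $ i) = - (1 / (u $ i - u $ j))" "1 / (v $ j - v $ i) = - (1 / (v $ i - v $ j))"
        using pos by (simp_all add: field_simps)
      then have "q j i = - a + e"
        using less_imp_neq[OF that] by (simp add: q_def a_def e_def add.commute)
      ultimately have "q i j * d $ i + q j i * d $ j = a * (d $ i - d $ j) + e * (d $ i + d $ j)"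
        by (simp only:) (simp add: algebra_simps)
      also have "\<dots> = a * ((u $ i - u $ j) - (v $ i - v $ j)) + e * ((u $ i + u $ j) - (v $ i + v $ j))"
        by (simp add: d_def algebra_simps)
      also have "\<dots> \<le> 0"
        unfolding a_def e_def using pos by (intro add_nonpos_nonpos inverse_diff_mult_diff_le_0)
      finally show ?thesis .
    qed
    show "q i j * d $ i + q j i * d $ j \<le> 0" for i j
      using *[of i j] *[of j i] by (cases i j rule: linorder_cases) (auto simp: q_def)
  qed
  finally show ?thesis
    by (simp add: d_def)
qed

section \<open>Perturbation estimates for the scaled drift\<close>

text \<open>Over a common denominator the numerator is \<open>(c\<^sup>2 - k) * A + c * B\<close> up
  to sign. Both it and the denominator are of order \<open>c\<close>, so \<open>c\<close> cancels
  and the bound is free of \<open>k\<close>. In the application, \<open>A\<close> is a difference or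
  sum of two coordinates of the flow and \<open>B\<close> the same for the noise.\<close>

lemma scaled_inverse_perturbation_bound:
  fixes A B k l \<beta> \<delta> :: real
  assumes k: "0 < k" and A: "\<delta> \<le> A" and \<delta>: "0 < \<delta>" and B: "\<bar>B\<bar> \<le> 2 * \<beta>"
    and l: "4 * \<beta> \<le> l * \<delta>" "0 \<le> l"
  defines "c \<equiv> sqrt k + l"
  shows "0 < c * A + B" and "\<bar>k / (c * A + B) - c / A\<bar> \<le> 4 * l / \<delta> + 4 * \<beta> / \<delta>\<^sup>2"
proof -
  have sk: "0 < sqrt k"
    using k by simp
  then have c: "0 < c" "l \<le> c"
    unfolding c_def using l sk by linarith+
  have A0: "0 < A"
    using A \<delta> by linarith
  have \<beta>: "0 \<le> \<beta>"
    using B by linarith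
  have "4 * \<beta> \<le> l * \<delta>"
    by fact
  also have "\<dots> \<le> c * A"
    using l c A \<delta> by (intro mult_mono) auto
  finally have "4 * \<beta> \<le> c * A" .
  \<comment> \<open>The perturbation \<open>B\<close> uses up at most half of
    \<open>c * A\<close>.\<close>
  then have half: "c * A / 2 \<le> c * A + B"
    using B by linarith
  have cA: "0 < c * A"
    using c A0 by simp
  show pos: "0 < c * A + B"
    using half cA by linarith
  \<comment> \<open>Here \<open>c\<^sup>2 - k\<close> equals
    \<open>2 * l * sqrt k + l\<^sup>2\<close>, so it grows only linearly in
    \<open>c\<close>.\<close>
  have ck: "0 \<le> c\<^sup>2 - k" "c\<^sup>2 - k \<le> 2 * l * c"
    using k sk l by (auto simp: c_def power2_eq_square algebra_simps)
  have "k / (c * A + B) - c / A = - ((c\<^sup>2 - k) * A + c * B) / ((c * A + B) * A)"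
    using pos A0 by (simp add: field_simps power2_eq_square)
  then have "\<bar>k / (c * A + B) - c / A\<bar> = \<bar>(c\<^sup>2 - k) * A + c * B\<bar> / ((c * A + B) * A)"
    using pos A0 by (simp add: abs_mult abs_divide)
  also have "\<dots> \<le> (2 * l * c * A + c * (2 * \<beta>)) / (c * A / 2 * A)"
  proof (rule frac_le)
    have "\<bar>(c\<^sup>2 - k) * A + c * B\<bar> \<le> \<bar>(c\<^sup>2 - k) * A\<bar> + \<bar>c * B\<bar>"
      by (rule abs_triangle_ineq)
    also have "\<dots> = (c\<^sup>2 - k) * A + c * \<bar>B\<bar>"
      using ck A0 c by (simp add: abs_mult)
    also have "\<dots> \<le> 2 * l * c * A + c * (2 * \<beta>)"
      using ck A0 c B by (intro add_mono mult_right_mono mult_left_mono) auto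
    finally show "\<bar>(c\<^sup>2 - k) * A + c * B\<bar> \<le> 2 * l * c * A + c * (2 * \<beta>)" .
    show "c * A / 2 * A \<le> (c * A + B) * A"
      using half A0 by (intro mult_right_mono) auto
  qed (use cA A0 c l \<beta> in auto)
  also have "\<dots> = 4 * l / A + 4 * \<beta> / A\<^sup>2"
    using A0 c by (simp add: field_simps power2_eq_square)
  also have "\<dots> \<le> 4 * l / \<delta> + 4 * \<beta> / \<delta>\<^sup>2"
    using A \<delta> A0 l \<beta> by (intro add_mono divide_left_mono power_mono) auto
  finally show "\<bar>k / (c * A + B) - c / A\<bar> \<le> 4 * l / \<delta> + 4 * \<beta> / \<delta>\<^sup>2" .
qed

text \<open>The scalar estimate is applied to every summand. One factor \<open>CARD('n)\<close>
  counts the summands of a component, the other comes from bounding the Euclidean norm by the l1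
  norm; the 2 accounts for the difference and the sum term.\<close>

lemma norm_scaled_drift_D_diff_le:
  fixes p b :: "'n::{finite,linorder} rvec"
  assumes k: "0 < k" and \<delta>: "0 < \<delta>"
    and p: "\<And>i j. i < j \<Longrightarrow> \<delta> \<le> p $ i - p $ j" "\<And>i j. i < j \<Longrightarrow> \<delta> \<le> p $ i + p $ j"
    and b: "\<And>i. \<bar>b $ i\<bar> \<le> \<beta>"
    and l: "4 * \<beta> \<le> l * \<delta>" "0 \<le> l"
  defines "c \<equiv> sqrt k + l"
  shows "c *\<^sub>R p + b \<in> open_chamber_D"
    and "norm (k *\<^sub>R drift_D (c *\<^sub>R p + b) - c *\<^sub>R drift_D p)
      \<le> real CARD('n) * (real CARD('n) * (2 * (4 * l / \<delta> + 4 * \<beta> / \<delta>\<^sup>2)))"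
proof -
  define g where "g = c *\<^sub>R p + b"
  define K where "K = 4 * l / \<delta> + 4 * \<beta> / \<delta>\<^sup>2"
  have B: "\<bar>b $ i - b $ j\<bar> \<le> 2 * \<beta>" "\<bar>b $ i + b $ j\<bar> \<le> 2 * \<beta>" for i j
    using b[of i] b[of j] by linarith+
  have gm: "g $ i - g $ j = c * (p $ i - p $ j) + (b $ i - b $ j)"
    and gp: "g $ i + g $ j = c * (p $ i + p $ j) + (b $ i + b $ j)" for i j
    by (simp_all add: g_def algebra_simps)
  have pos: "0 < g $ i - g $ j" "0 < g $ i + g $ j" if "i < j" for i j
    unfolding gm gp c_def
    using scaled_inverse_perturbation_bound(1)[OF k p(1)[OF that] \<delta> B(1) l]
      scaled_inverse_perturbation_bound(1)[OF k p(2)[OF that] \<delta> B(2) l] by auto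
  have "\<bar>g $ j\<bar> < g $ i" if "i < j" for i j
    using pos[OF that] by linarith
  then show "c *\<^sub>R p + b \<in> open_chamber_D"
    by (simp add: open_chamber_D_def g_def)
  define r where "r i j = k / (g $ i - g $ j) - c / (p $ i - p $ j)" for i j
  define s where "s i j = k / (g $ i + g $ j) - c / (p $ i + p $ j)" for i j
  have rs_less: "\<bar>r i j\<bar> \<le> K" "\<bar>s i j\<bar> \<le> K" if "i < j" for i j
    unfolding r_def s_def gm gp c_def K_def
    by (rule scaled_inverse_perturbation_bound(2)[OF k p(1)[OF that] \<delta> B(1) l]
        scaled_inverse_perturbation_bound(2)[OF k p(2)[OF that] \<delta> B(2) l])+
  \<comment> \<open>The scalar estimate covers only \<open>i < j\<close>; the reverse order follows
    as \<open>r\<close> is antisymmetric and \<open>s\<close> symmetric.\<close>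
  have rs: "\<bar>r i j + s i j\<bar> \<le> 2 * K" if "i \<noteq> j" for i j
  proof -
    have "r j i = - r i j"
      using minus_divide_right[of k "g $ i - g $ j"] minus_divide_right[of c "p $ i - p $ j"]
      by (simp add: r_def)
    moreover have "s j i = s i j"
      by (simp add: s_def add.commute)
    moreover have "\<bar>r i j\<bar> \<le> K \<and> \<bar>s i j\<bar> \<le> K \<or> \<bar>r j i\<bar> \<le> K \<and> \<bar>s j i\<bar> \<le> K"
      using that rs_less by (meson linorder_neqE)
    ultimately show ?thesis
      by linarith
  qed
  \<comment> \<open>Any index yields \<open>0 \<le> \<beta>\<close>, as index types are
    nonempty.\<close>
  have K: "0 \<le> K"
    using l \<delta> b[of undefined] by (simp add: K_def)
  define e where "e = k *\<^sub>R drift_D g - c *\<^sub>R drift_D p"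
  have e: "e $ i = (\<Sum>j\<in>UNIV - {i}. r i j + s i j)" for i
  proof -
    have "e $ i = (\<Sum>j\<in>UNIV - {i}. k * (1 / (g $ i - g $ j) + 1 / (g $ i + g $ j)) -
        c * (1 / (p $ i - p $ j) + 1 / (p $ i + p $ j)))"
      by (simp add: e_def drift_D_def sum_distrib_left sum_subtractf)
    also have "\<dots> = (\<Sum>j\<in>UNIV - {i}. r i j + s i j)"
      by (rule sum.cong) (simp_all add: r_def s_def distrib_left)
    finally show ?thesis .
  qed
  have "\<bar>e $ i\<bar> \<le> real CARD('n) * (2 * K)" for i
  proof -
    have "\<bar>e $ i\<bar> \<le> (\<Sum>j\<in>UNIV - {i}. \<bar>r i j + s i j\<bar>)"
      unfolding e by (rule sum_abs)
    also have "\<dots> \<le> (\<Sum>j\<in>UNIV - {i}. 2 * K)"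
      by (rule sum_mono) (use rs in auto)
    also have "\<dots> \<le> (\<Sum>j\<in>(UNIV :: 'n set). 2 * K)"
      by (rule sum_mono2) (use K in auto)
    finally show ?thesis
      by simp
  qed
  then have "(\<Sum>i\<in>UNIV. \<bar>e $ i\<bar>) \<le> (\<Sum>i\<in>(UNIV :: 'n set). real CARD('n) * (2 * K))"
    by (intro sum_mono)
  with norm_le_l1_cart[of e]
  show "norm (k *\<^sub>R drift_D (c *\<^sub>R p + b) - c *\<^sub>R drift_D p)
      \<le> real CARD('n) * (real CARD('n) * (2 * (4 * l / \<delta> + 4 * \<beta> / \<delta>\<^sup>2)))"
    by (simp add: e_def g_def K_def)
qed

section \<open>A norm bound for dissipative integral equations\<close>

lemma set_lebesgue_integral_Icc_diff:
  fixes h :: "real \<Rightarrow> 'a::{banach, second_countable_topology}"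
  assumes "set_integrable lborel {0..T} h" and "0 \<le> u" "u \<le> v" "v \<le> T"
  shows "(LINT s:{0..v}|lborel. h s) - (LINT s:{0..u}|lborel. h s) = (LINT s:{u<..v}|lborel. h s)"
proof -
  have "{0..v} = {0..u} \<union> {u<..v}"
    using assms by auto
  moreover have "set_integrable lborel {0..u} h" "set_integrable lborel {u<..v} h"
    using assms by (auto intro: set_integrable_subset)
  moreover have "{0..u} \<inter> {u<..v} = {}"
    by auto
  ultimately show ?thesis
    using set_integral_Un[of "{0..u}" "{u<..v}" lborel h] by simp
qed

text \<open>Formally the derivative of \<open>(norm w)\<^sup>2\<close> is
  \<open>2 * (h \<bullet> w)\<close>, which is at most \<open>2 * C * norm w\<close>. As
  \<open>h\<close> is merely integrable, differentiation is replaced by increments over short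
  intervals, with an error that is sent to zero.\<close>

lemma norm_le_of_dissipative:
  fixes h w :: "real \<Rightarrow> 'a::euclidean_space"
  assumes h: "set_integrable lborel {0..T} h"
    and cont: "continuous_on {0..T} w"
    and w: "\<And>t. t \<in> {0..T} \<Longrightarrow> w t = w0 + (LINT s:{0..t}|lborel. h s)"
    and diss: "AE s in lborel. s \<in> {0..T} \<longrightarrow> h s \<bullet> w s \<le> C * norm (w s)"
    and C: "0 \<le> C" and t: "t \<in> {0..T}"
  shows "norm (w t) \<le> norm w0 + 2 * C * T"
proof -
  have "compact {0..T}" "{0..T} \<noteq> {}" "continuous_on {0..T} (\<lambda>s. norm (w s))"
    using t cont by (auto intro: continuous_intros)
  \<comment> \<open>Bounding every \<open>norm (w s)\<close> by the maximum makes the estimate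
    linear in time, so no Gronwall argument is required.\<close>
  then obtain \<tau> where \<tau>: "\<tau> \<in> {0..T}" and max: "\<And>s. s \<in> {0..T} \<Longrightarrow> norm (w s) \<le> norm (w \<tau>)"
    using continuous_attains_sup by (metis (no_types, lifting))
  define S where "S = norm (w \<tau>)"
  define m where "m v = (LINT s:{0..v}|lborel. norm (h s))" for v
  have nh: "set_integrable lborel {0..T} (\<lambda>s. norm (h s))"
    using h by (rule set_integrable_norm)
  have m0: "0 \<le> m \<tau>"
    unfolding m_def set_lebesgue_integral_def by (intro integral_nonneg_AE) auto
  have step: "(norm (w \<tau>))\<^sup>2 - (norm (w 0))\<^sup>2 \<le> 2 * C * S * \<tau> + 2 * \<epsilon> * m \<tau>" if \<epsilon>: "0 < \<epsilon>" for \<epsilon>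
  proof -
    \<comment> \<open>The last term absorbs the error of replacing \<open>w u + w v\<close> by
      \<open>2 *\<^sub>R w s\<close> on short intervals; \<open>Q\<close> is shown to be
      nonincreasing.\<close>
    define Q where "Q v = (norm (w v))\<^sup>2 - 2 * C * S * v - 2 * \<epsilon> * m v" for v
    \<comment> \<open>The premise confines the claim to \<open>{0..T}\<close>, since the local case
      of \<open>Bolzano\<close> also presents intervals that stick out.\<close>
    define P where "P u v \<longleftrightarrow> (0 \<le> u \<and> v \<le> T \<longrightarrow> Q v \<le> Q u)" for u v
    have "0 \<le> \<tau>"
      using \<tau> by simp
    then have "P 0 \<tau>"
    proof (induction rule: Bolzano)
      case (trans a b c)
      then show ?case
        unfolding P_def by force
    next
      case (local x)
      with \<tau> have x: "x \<in> {0..T}"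
        by auto
      from cont[unfolded continuous_on_iff, rule_format, OF x, of "\<epsilon> / 2"] \<epsilon>
      obtain d where d: "d > 0"
        and osc: "\<And>s. s \<in> {0..T} \<Longrightarrow> dist s x < d \<Longrightarrow> dist (w s) (w x) < \<epsilon> / 2"
        by auto
      have "Q v \<le> Q u" if uv: "u \<le> x" "x \<le> v" "v - u < d" "0 \<le> u" "v \<le> T" for u v
      proof -
        have hI: "set_integrable lborel {u<..v} h"
          using h uv by (auto intro: set_integrable_subset)
        have nI: "set_integrable lborel {u<..v} (\<lambda>s. norm (h s))"
          using hI by (rule set_integrable_norm)
        have cI: "set_integrable lborel {u<..v} (\<lambda>s. 2 * C * S)"
          using uv by (simp add: set_integrable_def integrable_real_indicator)
        \<comment> \<open>A difference of squares factors as \<open>(w v - w u) \<bullet> z\<close>,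
          and \<open>z\<close> stays within \<open>2 * \<epsilon>\<close> of
          \<open>2 *\<^sub>R w s\<close> on the interval.\<close>
        define z where "z = w v + w u"
        have "(norm (w v))\<^sup>2 - (norm (w u))\<^sup>2 = (w v - w u) \<bullet> z"
          by (simp add: z_def power2_norm_eq_inner algebra_simps inner_commute)
        also have "w v - w u = (LINT s:{u<..v}|lborel. h s)"
          using set_lebesgue_integral_Icc_diff[OF h, of u v] uv by (simp add: w)
        also have "\<dots> \<bullet> z = (LINT s:{u<..v}|lborel. h s \<bullet> z)"
          using hI unfolding set_lebesgue_integral_def set_integrable_def
          by (simp add: integral_inner_left[symmetric])
        also have "\<dots> \<le> (LINT s:{u<..v}|lborel. 2 * C * S + 2 * \<epsilon> * norm (h s))"
        proof (rule set_integral_mono_AE)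
          show "set_integrable lborel {u<..v} (\<lambda>s. h s \<bullet> z)"
            using hI integrable_inner_left[of z lborel "\<lambda>s. indicator {u<..v} s *\<^sub>R h s"]
            by (simp add: set_integrable_def)
          show "set_integrable lborel {u<..v} (\<lambda>s. 2 * C * S + 2 * \<epsilon> * norm (h s))"
            by (rule set_integral_add(1)[OF cI set_integrable_mult_right[OF nI]])
          have pw: "h s \<bullet> z \<le> 2 * C * S + 2 * \<epsilon> * norm (h s)"
            if s: "s \<in> {u<..v}" and "h s \<bullet> w s \<le> C * norm (w s)" for s
          proof -
            have "dist s x < d" "dist u x < d" "dist v x < d"
              using s uv by (auto simp: dist_real_def)
            then have "dist (w s) (w x) < \<epsilon> / 2" "dist (w u) (w x) < \<epsilon> / 2" "dist (w v) (w x) < \<epsilon> / 2"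
              using s uv osc[of s] osc[of u] osc[of v] by auto
            then have "dist (w v) (w s) < \<epsilon>" "dist (w u) (w s) < \<epsilon>"
              using dist_triangle_half_r[of "w x" _ \<epsilon>] by (simp_all add: dist_commute)
            moreover have "z - 2 *\<^sub>R w s = (w v - w s) + (w u - w s)"
              by (simp add: z_def scaleR_2)
            ultimately have "norm (z - 2 *\<^sub>R w s) \<le> 2 * \<epsilon>"
              using norm_triangle_ineq[of "w v - w s" "w u - w s"] by (simp add: dist_norm)
            then have "h s \<bullet> (z - 2 *\<^sub>R w s) \<le> norm (h s) * (2 * \<epsilon>)"
              by (meson mult_left_mono norm_cauchy_schwarz norm_ge_zero order_trans)
            moreover have "C * norm (w s) \<le> C * S"
              using s uv C max[of s] by (intro mult_left_mono) (auto simp: S_def)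
            ultimately show ?thesis
              using that(2) by (simp add: inner_diff_right algebra_simps)
          qed
          show "AE s\<in>{u<..v} in lborel. h s \<bullet> z \<le> 2 * C * S + 2 * \<epsilon> * norm (h s)"
            using diss by eventually_elim (use pw uv in auto)
        qed
        also have "\<dots> = 2 * C * S * (v - u) + 2 * \<epsilon> * (LINT s:{u<..v}|lborel. norm (h s))"
        proof -
          have "(LINT s:{u<..v}|lborel. 2 * C * S) = 2 * C * S * (v - u)"
            using uv by (simp add: set_lebesgue_integral_def)
          then show ?thesis
            using set_integral_add(2)[OF cI, of "\<lambda>s. 2 * \<epsilon> * norm (h s)"] nI
            by simp
        qed
        also have "(LINT s:{u<..v}|lborel. norm (h s)) = m v - m u"
          using set_lebesgue_integral_Icc_diff[OF nh, of u v] uv by (simp add: m_def)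
        finally show ?thesis
          by (simp add: Q_def algebra_simps)
      qed
      with d show ?case
        unfolding P_def by (intro exI[of _ d]) auto
    qed
    moreover have "0 \<le> \<epsilon> * m 0"
      using \<epsilon> by (auto simp: m_def set_lebesgue_integral_def intro!: integral_nonneg_AE mult_nonneg_nonneg)
    ultimately show ?thesis
      using \<tau> by (simp add: P_def Q_def)
  qed
  have "S\<^sup>2 - (norm (w 0))\<^sup>2 \<le> 2 * C * S * \<tau>"
  proof (rule field_le_epsilon)
    fix e :: real
    assume e: "0 < e"
    \<comment> \<open>This choice of \<epsilon> keeps the error below \<open>e\<close>; adding 1
      avoids a division by zero.\<close>
    have "2 * (e / (2 * (m \<tau> + 1))) * m \<tau> \<le> e"
      using e m0 by (simp add: field_simps)
    with step[of "e / (2 * (m \<tau> + 1))"] e m0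
    show "S\<^sup>2 - (norm (w 0))\<^sup>2 \<le> 2 * C * S * \<tau> + e"
      by (simp add: S_def)
  qed
  moreover have "w 0 = w0"
  proof -
    have "(LINT s:{0..0}|lborel. h s) = 0"
      unfolding set_lebesgue_integral_def
      using AE_lborel_singleton[of 0] by (intro integral_eq_zero_AE) auto
    then show ?thesis
      using w[of 0] t by simp
  qed
  moreover have "C * S * \<tau> \<le> C * S * T"
    using C \<tau> by (intro mult_left_mono) (auto simp: S_def)
  \<comment> \<open>This makes \<open>S\<close> a common factor on the right; the case
    \<open>S = 0\<close> is covered by the nonnegativity of the final bound.\<close>
  moreover have "norm w0 * norm w0 \<le> S * norm w0"
    using max[of 0] t \<open>w 0 = w0\<close> by (intro mult_right_mono) (auto simp: S_def)
  ultimately have "S * S \<le> S * (norm w0 + 2 * C * T)"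
    by (simp add: power2_eq_square algebra_simps)
  moreover have "0 \<le> norm w0 + 2 * C * T"
    using C t by simp
  ultimately have "S \<le> norm w0 + 2 * C * T"
    by (smt (verit) mult_less_cancel_left_pos)
  then show ?thesis
    using max[OF t] by (simp add: S_def)
qed

section \<open>Gaps on compact sets and the flow line in integral form\<close>

text \<open>For each pair a continuous positive function attains its minimum on the compact set; the
  finitely many pairs then share one \<delta>.\<close>

lemma compact_subset_open_chamber_D_gap:
  fixes A :: "'n::{finite,linorder} rvec set"
  assumes "compact A" and "A \<subseteq> open_chamber_D"
  obtains \<delta> where "0 < \<delta>"
    and "\<And>z i j. z \<in> A \<Longrightarrow> i < j \<Longrightarrow> \<delta> \<le> z $ i - z $ j"
    and "\<And>z i j. z \<in> A \<Longrightarrow> i < j \<Longrightarrow> \<delta> \<le> z $ i + z $ j"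
proof -
  have "\<exists>d>0. \<forall>z\<in>A. i < j \<longrightarrow> d \<le> z $ i - \<bar>z $ j\<bar>" for i j
  proof (cases "A = {} \<or> \<not> i < j")
    \<comment> \<open>The bound is vacuous here; a positive default keeps the minimum over all pairs
      positive.\<close>
    case True
    then show ?thesis
      by (intro exI[of _ 1]) auto
  next
    case False
    have "continuous_on A (\<lambda>z. z $ i - \<bar>z $ j\<bar>)"
      by (intro continuous_intros)
    with \<open>compact A\<close> False obtain z where "z \<in> A" "\<forall>z'\<in>A. z $ i - \<bar>z $ j\<bar> \<le> z' $ i - \<bar>z' $ j\<bar>"
      using continuous_attains_inf by blast
    moreover have "0 < z $ i - \<bar>z $ j\<bar>"
      using False \<open>z \<in> A\<close> assms(2) by (auto simp: open_chamber_D_def)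
    ultimately show ?thesis
      by blast
  qed
  then obtain d where d: "\<And>i j. 0 < d i j"
    "\<And>i j z. z \<in> A \<Longrightarrow> i < j \<Longrightarrow> d i j \<le> z $ i - \<bar>z $ j\<bar>"
    by metis
  define \<delta> where "\<delta> = Min (range (case_prod d))"
  have "\<delta> \<le> d i j" for i j
    unfolding \<delta>_def by (rule Min_le) (auto intro: rev_image_eqI[of "(i, j)"])
  with d(2) have gap: "\<delta> \<le> z $ i - \<bar>z $ j\<bar>" if "z \<in> A" "i < j" for z i j
    using that by (meson order_trans)
  show thesis
  proof (rule that)
    show "0 < \<delta>"
      using d(1) by (auto simp: \<delta>_def)
    show "\<delta> \<le> z $ i - z $ j" "\<delta> \<le> z $ i + z $ j" if "z \<in> A" "i < j" for z i j
      using gap[OF that] by linarith+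
  qed
qed

lemma continuous_on_drift_D:
  "continuous_on (open_chamber_D :: 'n::{finite,linorder} rvec set) drift_D"
proof -
  have "z $ i - z $ j \<noteq> 0 \<and> z $ i + z $ j \<noteq> 0"
    if "z \<in> open_chamber_D" "i \<noteq> j" for z :: "'n rvec" and i j
    using that open_chamber_D_gaps[of z i j] open_chamber_D_gaps[of z j i]
    by (cases i j rule: linorder_cases) auto
  then show ?thesis
    unfolding drift_D_def[abs_def]
    by (intro continuous_on_vec_lambda continuous_intros) auto
qed

lemma flow_line_D_continuous:
  assumes "flow_line_D x \<phi>"
  shows "continuous_on {0..} \<phi>"
  by (rule continuous_on_vector_derivative[where f' = "\<lambda>s. drift_D (\<phi> s)"])
    (use assms in \<open>auto simp: flow_line_D_def\<close>)

text \<open>This matches the form of \<open>bessel_path_D\<close>, so that the two equations can be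
  subtracted.\<close>

lemma flow_line_D_integral:
  assumes \<phi>: "flow_line_D x \<phi>" and t: "0 \<le> t"
  shows "set_integrable lborel {0..t} (\<lambda>s. drift_D (\<phi> s))"
    and "\<phi> t = x + (LINT s:{0..t}|lborel. drift_D (\<phi> s))"
proof -
  have deriv: "(\<phi> has_vector_derivative drift_D (\<phi> s)) (at s within {0..t})" if "0 \<le> s" "s \<le> t" for s
    using \<phi> that has_vector_derivative_within_subset[of \<phi> "drift_D (\<phi> s)" s "{0..}" "{0..t}"]
    by (auto simp: flow_line_D_def)
  have "continuous_on {0..t} \<phi>"
    using flow_line_D_continuous[OF \<phi>] by (rule continuous_on_subset) auto
  moreover have "\<phi> ` {0..t} \<subseteq> open_chamber_D"
    using \<phi> interior_chamber_D_subset by (auto simp: flow_line_D_def)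
  ultimately have cont: "continuous_on {0..t} (\<lambda>s. drift_D (\<phi> s))"
    using continuous_on_compose2[OF continuous_on_drift_D] by blast
  then show "set_integrable lborel {0..t} (\<lambda>s. drift_D (\<phi> s))"
    unfolding set_integrable_def by (rule borel_integrable_compact[OF compact_Icc])
  show "\<phi> t = x + (LINT s:{0..t}|lborel. drift_D (\<phi> s))"
    using integral_FTC_atLeastAtMost[OF t deriv cont] \<phi>
    by (simp add: set_lebesgue_integral_def flow_line_D_def)
qed

section \<open>Comparison of a single path with the flow\<close>

lemma bessel_path_D_flow_distance:
  fixes b \<phi> :: "real \<Rightarrow> 'n::{finite,linorder} rvec"
  assumes \<phi>: "flow_line_D x \<phi>" and b: "continuous_on {0..} b" and T: "0 \<le> T"
  obtains K where "\<And>k f s. 0 < k \<Longrightarrow> bessel_path_D k (sqrt k *\<^sub>R x + y) b f \<Longrightarrow> s \<in> {0..T}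
    \<Longrightarrow> norm (f s - sqrt k *\<^sub>R \<phi> s) \<le> K"
proof -
  have chamber: "\<phi> s \<in> open_chamber_D" if "0 \<le> s" for s
    using \<phi> that interior_chamber_D_subset by (auto simp: flow_line_D_def)
  have cont_\<phi>: "continuous_on {0..T} \<phi>"
    using flow_line_D_continuous[OF \<phi>] by (rule continuous_on_subset) auto
  have cont_b: "continuous_on {0..T} b"
    using b by (rule continuous_on_subset) auto
  have cpt: "compact (\<phi> ` {0..T})" "compact (b ` {0..T})"
    using cont_\<phi> cont_b by (auto intro: compact_continuous_image)
  obtain \<delta> where \<delta>: "0 < \<delta>"
    and gaps: "\<And>s i j. s \<in> {0..T} \<Longrightarrow> i < j \<Longrightarrow> \<delta> \<le> \<phi> s $ i - \<phi> s $ j"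
      "\<And>s i j. s \<in> {0..T} \<Longrightarrow> i < j \<Longrightarrow> \<delta> \<le> \<phi> s $ i + \<phi> s $ j"
    using compact_subset_open_chamber_D_gap[OF cpt(1)] chamber
    by (metis (no_types, lifting) atLeastAtMost_iff image_eqI image_subsetI)
  obtain P where P: "\<And>s. s \<in> {0..T} \<Longrightarrow> norm (\<phi> s) \<le> P"
    using compact_imp_bounded[OF cpt(1)] unfolding bounded_iff by blast
  obtain \<beta> where \<beta>: "\<And>s. s \<in> {0..T} \<Longrightarrow> norm (b s) \<le> \<beta>"
    using compact_imp_bounded[OF cpt(2)] unfolding bounded_iff by blast
  have "norm (b 0) \<le> \<beta>"
    using \<beta>[of 0] T by simp
  then have "0 \<le> \<beta>"
    using norm_ge_zero order_trans by blast
  \<comment> \<open>The gap of \<open>l *\<^sub>R \<phi> s\<close> is then at least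
    \<open>4 * \<beta>\<close>, twice what \<open>b s\<close> can change in a difference or sum of
    coordinates.\<close>
  define l where "l = 4 * \<beta> / \<delta>"
  have l: "4 * \<beta> \<le> l * \<delta>" "0 \<le> l"
    using \<delta> \<open>0 \<le> \<beta>\<close> by (auto simp: l_def)
  define C where "C = real CARD('n) * (real CARD('n) * (2 * (4 * l / \<delta> + 4 * \<beta> / \<delta>\<^sup>2)))"
  have "0 \<le> C"
    using l \<delta> \<open>0 \<le> \<beta>\<close> by (simp add: C_def)
  show thesis
  proof (rule that)
    fix k f s
    assume k: "0 < k" and path: "bessel_path_D k (sqrt k *\<^sub>R x + y) b f" and s: "s \<in> {0..T}"
    define c where "c = sqrt k + l"
    define w where "w s = f s - b s - c *\<^sub>R \<phi> s" for s
    define h where "h s = k *\<^sub>R drift_D (f s) - c *\<^sub>R drift_D (\<phi> s)" for s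
    have int_f: "set_integrable lborel {0..t} (\<lambda>s. drift_D (f s))"
      and eq_f: "f t = sqrt k *\<^sub>R x + y + b t + k *\<^sub>R (LINT s:{0..t}|lborel. drift_D (f s))"
      if "0 \<le> t" for t
      using path that by (auto simp: bessel_path_D_def)
    note int_\<phi> = flow_line_D_integral[OF \<phi>]
    \<comment> \<open>The terms \<open>sqrt k *\<^sub>R x\<close> cancel in the initial value of
      \<open>w\<close>, which leaves a bound free of \<open>k\<close>.\<close>
    have "norm (w s) \<le> norm (y - l *\<^sub>R x) + 2 * C * T"
    proof (rule norm_le_of_dissipative)
      show "set_integrable lborel {0..T} h"
        unfolding h_def using int_f[OF T] int_\<phi>(1)[OF T]
        by (intro set_integral_diff(1) set_integrable_scaleR_right)
      have "continuous_on {0..T} f"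
        using path by (auto simp: bessel_path_D_def intro: continuous_on_subset)
      then show "continuous_on {0..T} w"
        unfolding w_def by (intro continuous_intros cont_b cont_\<phi>)
      show "w t = y - l *\<^sub>R x + (LINT s:{0..t}|lborel. h s)" if "t \<in> {0..T}" for t
      proof -
        from that have t: "0 \<le> t"
          by simp
        have "(LINT s:{0..t}|lborel. h s) =
            k *\<^sub>R (LINT s:{0..t}|lborel. drift_D (f s)) - c *\<^sub>R (LINT s:{0..t}|lborel. drift_D (\<phi> s))"
          unfolding h_def using int_f[OF t] int_\<phi>(1)[OF t]
          by (simp add: set_integral_diff(2) set_integrable_scaleR_right)
        also have "k *\<^sub>R (LINT s:{0..t}|lborel. drift_D (f s)) = f t - b t - sqrt k *\<^sub>R x - y"
          by (subst eq_f[OF t]) simp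
        also have "(LINT s:{0..t}|lborel. drift_D (\<phi> s)) = \<phi> t - x"
          by (subst int_\<phi>(2)[OF t]) simp
        finally show ?thesis
          by (simp add: w_def c_def algebra_simps)
      qed
      have "AE s in lborel. 0 \<le> s \<longrightarrow> f s \<in> interior chamber_D"
        using path unfolding bessel_path_D_def by blast
      then show "AE s in lborel. s \<in> {0..T} \<longrightarrow> h s \<bullet> w s \<le> C * norm (w s)"
      proof (eventually_elim, intro impI)
        fix s
        assume "0 \<le> s \<longrightarrow> f s \<in> interior chamber_D" and s: "s \<in> {0..T}"
        then have f: "f s \<in> open_chamber_D"
          using interior_chamber_D_subset by auto
        define g where "g = c *\<^sub>R \<phi> s + b s"
        have b_le: "\<bar>b s $ i\<bar> \<le> \<beta>" for i
          using component_le_norm_cart[of "b s" i] \<beta>[OF s] by linarith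
        note pert = norm_scaled_drift_D_diff_le[OF k \<delta> gaps(1)[OF s] gaps(2)[OF s] b_le l, folded c_def, folded g_def C_def]
        \<comment> \<open>The first part is handled by monotonicity, the second by the perturbation
          estimate.\<close>
        have "h s = k *\<^sub>R (drift_D (f s) - drift_D g) + (k *\<^sub>R drift_D g - c *\<^sub>R drift_D (\<phi> s))"
          by (simp add: h_def scaleR_diff_right)
        then have "h s \<bullet> w s = k * ((drift_D (f s) - drift_D g) \<bullet> w s) +
            (k *\<^sub>R drift_D g - c *\<^sub>R drift_D (\<phi> s)) \<bullet> w s"
          by (simp only: inner_add_left inner_scaleR_left)
        also have "\<dots> \<le> 0 + C * norm (w s)"
        proof (rule add_mono)
          have "w s = f s - g"
            by (simp add: w_def g_def)
          then show "k * ((drift_D (f s) - drift_D g) \<bullet> w s) \<le> 0"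
            using drift_D_monotone[OF f pert(1)] k by (simp add: mult_nonneg_nonpos)
          show "(k *\<^sub>R drift_D g - c *\<^sub>R drift_D (\<phi> s)) \<bullet> w s \<le> C * norm (w s)"
            using norm_cauchy_schwarz mult_right_mono[OF pert(2) norm_ge_zero] by (rule order_trans)
        qed
        finally show "h s \<bullet> w s \<le> C * norm (w s)"
          by simp
      qed
    qed (use \<open>0 \<le> C\<close> s in auto)
    \<comment> \<open>Returning from the shifted comparison path costs only terms bounded on
      \<open>{0..T}\<close>.\<close>
    moreover have "f s - sqrt k *\<^sub>R \<phi> s = w s + b s + l *\<^sub>R \<phi> s"
      by (simp add: w_def c_def algebra_simps)
    then have "norm (f s - sqrt k *\<^sub>R \<phi> s) \<le> norm (w s) + norm (b s) + norm (l *\<^sub>R \<phi> s)"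
      by (metis norm_triangle_mono norm_triangle_ineq order_refl)
    moreover have "norm (l *\<^sub>R \<phi> s) \<le> l * P"
      using l P[OF s] by (simp add: mult_left_mono)
    ultimately show "norm (f s - sqrt k *\<^sub>R \<phi> s) \<le> (norm (y - l *\<^sub>R x) + 2 * C * T) + \<beta> + l * P"
      using \<beta>[OF s] by linarith
  qed
qed

section \<open>Density arguments, measurability and convergence in probability\<close>

text \<open>A value above \<open>a\<close> would persist on a relatively open set, which meets
  \<open>D\<close>. This serves both for the parameter \<open>k\<close> and for time.\<close>

lemma continuous_on_le_of_dense:
  fixes f :: "'a::topological_space \<Rightarrow> real"
  assumes f: "continuous_on S f" and D: "D \<subseteq> S" "S \<subseteq> closure D"
    and le: "\<And>d. d \<in> D \<Longrightarrow> f d \<le> a" and s: "s \<in> S"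
  shows "f s \<le> a"
proof (rule ccontr)
  assume "\<not> f s \<le> a"
  obtain U where U: "open U" "U \<inter> S = f -` {a<..} \<inter> S"
    using f open_greaterThan by (metis continuous_on_open_invariant)
  have "s \<in> U \<inter> closure D"
    using U(2) s D \<open>\<not> f s \<le> a\<close> by auto
  then obtain d where "d \<in> U" "d \<in> D"
    using open_Int_closure_eq_empty[OF U(1), of D] by blast
  then have "a < f d"
    using U(2) D by auto
  with le[OF \<open>d \<in> D\<close>] show False
    by simp
qed

text \<open>Where the path is continuous, the supremum exceeds \<epsilon> iff the path does so on a
  countable dense set of times. The remaining part lies in a null set and is measurable in the
  completion.\<close>

lemma sets_completion_SUP_greater:
  fixes Y :: "'a::{metric_space, second_countable_topology} \<Rightarrow> 'w \<Rightarrow> real"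
  assumes Y: "\<And>t. t \<in> S \<Longrightarrow> Y t \<in> borel_measurable (completion M)"
    and cont: "AE \<omega> in M. continuous_on S (\<lambda>t. Y t \<omega>)"
  shows "{\<omega> \<in> space M. (SUP t\<in>S. ereal (Y t \<omega>)) > ereal \<epsilon>} \<in> sets (completion M)"
proof -
  obtain D where D: "countable D" "D \<subseteq> S" "S \<subseteq> closure D"
    by (rule separable)
  define E where "E = {\<omega> \<in> space M. (SUP t\<in>S. ereal (Y t \<omega>)) > ereal \<epsilon>}"
  define E' where "E' = (\<Union>t\<in>D. {\<omega> \<in> space (completion M). \<epsilon> < Y t \<omega>})"
  have "{\<omega> \<in> space (completion M). \<epsilon> < Y t \<omega>} \<in> sets (completion M)" if "t \<in> D" for t
    using Y[of t] that D(2) by (intro borel_measurable_less) auto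
  then have E': "E' \<in> sets (completion M)"
    unfolding E'_def using D(1) by (intro sets.countable_UN') auto
  obtain N where N: "N \<in> null_sets M" "{\<omega> \<in> space M. \<not> continuous_on S (\<lambda>t. Y t \<omega>)} \<subseteq> N"
    using cont by (auto simp: eventually_ae_filter)
  have "\<omega> \<in> E \<longleftrightarrow> \<omega> \<in> E'" if "\<omega> \<notin> N" for \<omega>
  proof (cases "\<omega> \<in> space M")
    case True
    with that N(2) have "continuous_on S (\<lambda>t. Y t \<omega>)"
      by auto
    from continuous_on_le_of_dense[OF this D(2,3), of \<epsilon>] D(2)
    have "(\<exists>t\<in>S. \<epsilon> < Y t \<omega>) \<longleftrightarrow> (\<exists>t\<in>D. \<epsilon> < Y t \<omega>)"
      by (meson not_le subsetD)
    with True show ?thesis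
      by (simp add: E_def E'_def less_SUP_iff)
  qed (simp add: E_def E'_def)
  then have "E = (E' - N) \<union> (E \<inter> N)"
    by blast
  moreover have "N \<in> null_sets (completion M)"
    using N(1) by (rule null_sets_completionI)
  then have "E \<inter> N \<in> sets (completion M)" "N \<in> sets (completion M)"
    by (auto intro: completion.complete)
  ultimately show ?thesis
    using E' unfolding E_def[symmetric] by (metis sets.Diff sets.Un)
qed

lemma (in prob_space) tendsto_measure_completion_of_AE_eventually_not_in:
  fixes E :: "real \<Rightarrow> 'a set"
  assumes E: "\<And>k. k0 \<le> k \<Longrightarrow> E k \<in> sets (completion M)"
    and ev: "AE \<omega> in M. eventually (\<lambda>k. \<omega> \<notin> E k) at_top"
  shows "((\<lambda>k. measure (completion M) (E k)) \<longlongrightarrow> 0) at_top"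
proof -
  interpret C: prob_space "completion M"
    by (rule prob_space_completion)
  \<comment> \<open>Truncation at \<open>k0\<close> makes every set measurable and changes nothing
    for large \<open>k\<close>.\<close>
  define F where "F k = E (max k0 k)" for k
  have F: "F k \<in> sets (completion M)" for k
    by (simp add: F_def E)
  have F_E: "eventually (\<lambda>k. F k = E k) at_top"
    using eventually_ge_at_top[of k0] by eventually_elim (simp add: F_def max_absorb2)
  have "((\<lambda>k. \<integral>\<omega>. indicat_real (F k) \<omega> \<partial>completion M) \<longlongrightarrow> (\<integral>\<omega>. 0 \<partial>completion M)) at_top"
  proof (rule integral_dominated_convergence_at_top)
    show "AE \<omega> in completion M. ((\<lambda>k. indicat_real (F k) \<omega>) \<longlongrightarrow> 0) at_top"
      unfolding AE_completion_iff using ev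
    proof eventually_elim
      fix \<omega>
      assume "eventually (\<lambda>k. \<omega> \<notin> E k) at_top"
      then have "eventually (\<lambda>k. indicat_real (F k) \<omega> = 0) at_top"
        using F_E by eventually_elim simp
      then show "((\<lambda>k. indicat_real (F k) \<omega>) \<longlongrightarrow> 0) at_top"
        by (rule tendsto_eventually)
    qed
    show "integrable (completion M) (\<lambda>_. 1 :: real)"
      by simp
    show "\<forall>\<^sub>F k in at_top. AE \<omega> in completion M. norm (indicat_real (F k) \<omega>) \<le> 1"
      by (simp add: indicator_def)
  qed (use F in auto)
  then have "((\<lambda>k. measure (completion M) (F k)) \<longlongrightarrow> 0) at_top"
    using F sets.sets_into_space[OF F] by (simp add: Int_absorb1 Int_absorb2)
  then show ?thesis
    by (rule Lim_transform_eventually) (use F_E in eventually_elim, simp)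
qed

text \<open>The filtration contains the null sets of the completion, so adapted processes are
  treated as measurable with respect to \<open>completion M\<close>.\<close>

lemma subalgebra_completion_augmented_filtration:
  assumes B: "\<And>s. 0 \<le> s \<Longrightarrow> B s \<in> borel_measurable M"
  shows "subalgebra (completion M) (augmented_filtration M B t)"
proof -
  let ?G = "{B s -` A \<inter> space M | s A. 0 \<le> s \<and> s \<le> t \<and> A \<in> sets borel} \<union> null_sets (completion M)"
  have "?G \<subseteq> sets (completion M)"
    using B by (auto intro: measurable_sets sets_completionI_sets)
  moreover from this have "?G \<subseteq> Pow (space M)"
    using sets.space_closed[of "completion M"] by auto
  ultimately show ?thesis
    using sets.sigma_sets_subset[of ?G "completion M"]
    by (simp add: subalgebra_def augmented_filtration_def space_measure_of sets_measure_of)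
qed

section \<open>Bounds uniform in the multiplicity and the limit theorem\<close>

lemma bessel_family_D_flow_distance:
  fixes B :: "real \<Rightarrow> 'w \<Rightarrow> 'n::{finite,linorder} rvec"
  assumes B: "brownian_motion M B" and k0: "0 < k0"
    and X: "bessel_family_D M B k0 (\<lambda>k. sqrt k *\<^sub>R x + y) X"
    and \<phi>: "flow_line_D x \<phi>"
  shows "AE \<omega> in M. \<forall>T\<ge>0. \<exists>K. \<forall>s\<in>{0..T}. \<forall>k\<ge>k0. norm (X k s \<omega> - sqrt k *\<^sub>R \<phi> s) \<le> K"
proof -
  obtain D where D: "countable D" "D \<subseteq> {k0..}" "{k0..} \<subseteq> closure D"
    by (rule separable)
  have "AE \<omega> in M. continuous_on {0..} (\<lambda>t. B t \<omega>)"
    using B by (simp add: brownian_motion_def)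
  moreover have "AE \<omega> in M. \<forall>t\<ge>0. continuous_on {k0..} (\<lambda>k. X k t \<omega>)"
    using X by (simp add: bessel_family_D_def)
  \<comment> \<open>The exceptional null set may depend on \<open>k\<close>; countably many of them
    can be merged.\<close>
  moreover have "AE \<omega> in M. \<forall>k\<in>D. bessel_path_D k (sqrt k *\<^sub>R x + y) (\<lambda>t. B t \<omega>) (\<lambda>t. X k t \<omega>)"
    using X D by (auto simp: AE_ball_countable bessel_family_D_def bessel_process_D_def)
  ultimately show ?thesis
  proof (eventually_elim, intro allI impI)
    fix \<omega> and T :: real
    assume contB: "continuous_on {0..} (\<lambda>t. B t \<omega>)"
      and contX: "\<forall>t\<ge>0. continuous_on {k0..} (\<lambda>k. X k t \<omega>)"
      and path: "\<forall>k\<in>D. bessel_path_D k (sqrt k *\<^sub>R x + y) (\<lambda>t. B t \<omega>) (\<lambda>t. X k t \<omega>)"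
      and T: "0 \<le> T"
    obtain K where K: "\<And>k f s. 0 < k \<Longrightarrow> bessel_path_D k (sqrt k *\<^sub>R x + y) (\<lambda>t. B t \<omega>) f \<Longrightarrow>
        s \<in> {0..T} \<Longrightarrow> norm (f s - sqrt k *\<^sub>R \<phi> s) \<le> K"
      using bessel_path_D_flow_distance[OF \<phi> contB T] by blast
    have "norm (X k s \<omega> - sqrt k *\<^sub>R \<phi> s) \<le> K" if "s \<in> {0..T}" "k0 \<le> k" for s k
    proof (rule continuous_on_le_of_dense[where f = "\<lambda>k. norm (X k s \<omega> - sqrt k *\<^sub>R \<phi> s)", OF _ D(2,3)])
      have "continuous_on {k0..} (\<lambda>k. X k s \<omega>)"
        using contX that by simp
      then show "continuous_on {k0..} (\<lambda>k. norm (X k s \<omega> - sqrt k *\<^sub>R \<phi> s))"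
        by (intro continuous_intros)
      show "norm (X d s \<omega> - sqrt d *\<^sub>R \<phi> s) \<le> K" if "d \<in> D" for d
        using K[where k = d and f = "\<lambda>t. X d t \<omega>" and s = s] path that \<open>s \<in> {0..T}\<close> D(2) k0 by force
    qed (use that in auto)
    then show "\<exists>K. \<forall>s\<in>{0..T}. \<forall>k\<ge>k0. norm (X k s \<omega> - sqrt k *\<^sub>R \<phi> s) \<le> K"
      by blast
  qed
qed

lemma uniform_limit_rescaled:
  fixes F :: "real \<Rightarrow> 'a \<Rightarrow> 'b::real_normed_vector"
  assumes "\<And>s k. s \<in> S \<Longrightarrow> k0 \<le> k \<Longrightarrow> norm (F k s - sqrt k *\<^sub>R \<psi> s) \<le> K"
  shows "uniform_limit S (\<lambda>k s. F k s /\<^sub>R sqrt k) \<psi> at_top"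
proof (rule uniform_limitI)
  fix e :: real
  assume e: "0 < e"
  have "filterlim sqrt at_top at_top"
    by (rule sqrt_at_top)
  \<comment> \<open>The summand 1 makes the final inequality strict; the absolute value covers a
    negative \<open>K\<close>, possible for empty \<open>S\<close>.\<close>
  then have "eventually (\<lambda>k. (\<bar>K\<bar> + 1) / e \<le> sqrt k) at_top"
    by (simp add: filterlim_at_top)
  then show "\<forall>\<^sub>F k in at_top. \<forall>s\<in>S. dist (F k s /\<^sub>R sqrt k) (\<psi> s) < e"
    using eventually_ge_at_top[of k0] eventually_gt_at_top[of 0]
  proof (eventually_elim, intro ballI)
    fix k s
    assume k: "(\<bar>K\<bar> + 1) / e \<le> sqrt k" "k0 \<le> k" "0 < k" and s: "s \<in> S"
    have "F k s /\<^sub>R sqrt k - \<psi> s = (F k s - sqrt k *\<^sub>R \<psi> s) /\<^sub>R sqrt k"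
      using k(3) by (simp add: scaleR_diff_right)
    then have "dist (F k s /\<^sub>R sqrt k) (\<psi> s) = norm (F k s - sqrt k *\<^sub>R \<psi> s) / sqrt k"
      using k(3) by (simp add: dist_norm divide_inverse mult.commute)
    also have "\<dots> \<le> \<bar>K\<bar> / sqrt k"
      using assms[OF s k(2)] k(3) by (intro divide_right_mono) auto
    also have "\<dots> < e"
      using k(1,3) e by (simp add: field_simps)
    finally show "dist (F k s /\<^sub>R sqrt k) (\<psi> s) < e" .
  qed
qed

text \<open>In \<open>ereal\<close> an unbounded set of reals has supremum infinity, so
  \<open>< \<infinity>\<close> really expresses boundedness.\<close>

theorem theorem5p5:
  fixes M :: "'w measure"
    and B :: "real \<Rightarrow> 'w \<Rightarrow> 'n::{finite,linorder} rvec"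
    and X :: "real \<Rightarrow> real \<Rightarrow> 'w \<Rightarrow> 'n rvec"
    and \<phi> :: "real \<Rightarrow> 'n rvec \<Rightarrow> 'n rvec"
    and x y :: "'n rvec"
    and k0 :: real
  assumes "brownian_motion M B"
    and "x \<in> interior chamber_D"
    and "k0 \<ge> 1 / 2"
    and "\<And>k. k \<ge> k0 \<Longrightarrow> sqrt k *\<^sub>R x + y \<in> interior chamber_D"
    and "bessel_family_D M B k0 (\<lambda>k. sqrt k *\<^sub>R x + y) X"
    and "flow_line_D x (\<lambda>t. \<phi> t x)"
  shows "(\<forall>t>0. AE \<omega> in M.
            (SUP (s, k)\<in>{0..t} \<times> {k0..}. ereal (norm (X k s \<omega> - sqrt k *\<^sub>R \<phi> s x))) < \<infinity>) \<and>
         (AE \<omega> in M. \<forall>T\<ge>0.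
            uniform_limit {0..T} (\<lambda>k t. X k t \<omega> /\<^sub>R sqrt k) (\<lambda>t. \<phi> t x) at_top) \<and>
         (\<forall>T\<ge>0. \<forall>\<epsilon>>0.
            let E = (\<lambda>k. {\<omega> \<in> space M.
                       (SUP t\<in>{0..T}. ereal (norm (X k t \<omega> /\<^sub>R sqrt k - \<phi> t x))) > ereal \<epsilon>})
            in (\<forall>k\<ge>k0. E k \<in> sets (completion M)) \<and>
               ((\<lambda>k. measure (completion M) (E k)) \<longlongrightarrow> 0) at_top)"
proof -
  interpret prob_space M
    using assms(1) by (simp add: brownian_motion_def)
  have "0 < k0"
    using assms(3) by simp
  note bound = bessel_family_D_flow_distance[OF assms(1) this assms(5,6)]
  have unif: "AE \<omega> in M. \<forall>T\<ge>0. uniform_limit {0..T} (\<lambda>k t. X k t \<omega> /\<^sub>R sqrt k) (\<lambda>t. \<phi> t x) at_top"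
    using bound
  proof (eventually_elim, intro allI impI)
    fix \<omega> and T :: real
    assume "\<forall>T\<ge>0. \<exists>K. \<forall>s\<in>{0..T}. \<forall>k\<ge>k0. norm (X k s \<omega> - sqrt k *\<^sub>R \<phi> s x) \<le> K" and "0 \<le> T"
    then obtain K where "\<forall>s\<in>{0..T}. \<forall>k\<ge>k0. norm (X k s \<omega> - sqrt k *\<^sub>R \<phi> s x) \<le> K"
      by blast
    then show "uniform_limit {0..T} (\<lambda>k t. X k t \<omega> /\<^sub>R sqrt k) (\<lambda>t. \<phi> t x) at_top"
      by (intro uniform_limit_rescaled[where ?k0.0 = k0 and K = K]) auto
  qed
  have "AE \<omega> in M. (SUP (s, k)\<in>{0..t} \<times> {k0..}. ereal (norm (X k s \<omega> - sqrt k *\<^sub>R \<phi> s x))) < \<infinity>"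
    if "0 < t" for t
    using bound
  proof eventually_elim
    fix \<omega>
    assume "\<forall>T\<ge>0. \<exists>K. \<forall>s\<in>{0..T}. \<forall>k\<ge>k0. norm (X k s \<omega> - sqrt k *\<^sub>R \<phi> s x) \<le> K"
    then obtain K where "\<forall>s\<in>{0..t}. \<forall>k\<ge>k0. norm (X k s \<omega> - sqrt k *\<^sub>R \<phi> s x) \<le> K"
      using that by (auto dest: spec[of _ t])
    then have "(SUP (s, k)\<in>{0..t} \<times> {k0..}. ereal (norm (X k s \<omega> - sqrt k *\<^sub>R \<phi> s x))) \<le> ereal K"
      by (intro SUP_least) auto
    then show "(SUP (s, k)\<in>{0..t} \<times> {k0..}. ereal (norm (X k s \<omega> - sqrt k *\<^sub>R \<phi> s x))) < \<infinity>"
      by (rule order.strict_trans1) simp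
  qed
  \<comment> \<open>Convergence in probability: almost every \<omega> eventually leaves
    \<open>E k\<close>, so the measures tend to zero.\<close>
  moreover have "(\<forall>k\<ge>k0. E k \<in> sets (completion M)) \<and>
      ((\<lambda>k. measure (completion M) (E k)) \<longlongrightarrow> 0) at_top"
    if "0 \<le> T" "0 < \<epsilon>" and E: "E = (\<lambda>k. {\<omega> \<in> space M.
      (SUP t\<in>{0..T}. ereal (norm (X k t \<omega> /\<^sub>R sqrt k - \<phi> t x))) > ereal \<epsilon>})" for T \<epsilon> E
  proof -
    have meas: "E k \<in> sets (completion M)" if k: "k0 \<le> k" for k
      unfolding E
    proof (rule sets_completion_SUP_greater)
      from k have X: "bessel_process_D M B k (sqrt k *\<^sub>R x + y) (X k)"
        using assms(5) by (simp add: bessel_family_D_def)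
      have "subalgebra (completion M) (augmented_filtration M B t)" for t
        using assms(1) by (intro subalgebra_completion_augmented_filtration)
          (simp add: brownian_motion_def)
      with X have "X k t \<in> borel_measurable (completion M)" if "t \<in> {0..T}" for t
        using that by (auto simp: bessel_process_D_def intro: measurable_from_subalg)
      then show "(\<lambda>\<omega>. norm (X k t \<omega> /\<^sub>R sqrt k - \<phi> t x)) \<in> borel_measurable (completion M)"
        if "t \<in> {0..T}" for t
        using that by measurable
      have "continuous_on {0..} (\<lambda>t. \<phi> t x)"
        using assms(6) by (rule flow_line_D_continuous)
      then have \<phi>: "continuous_on {0..T} (\<lambda>t. \<phi> t x)"
        by (rule continuous_on_subset) auto
      have "AE \<omega> in M. bessel_path_D k (sqrt k *\<^sub>R x + y) (\<lambda>t. B t \<omega>) (\<lambda>t. X k t \<omega>)"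
        using X by (simp add: bessel_process_D_def)
      then show "AE \<omega> in M. continuous_on {0..T} (\<lambda>t. norm (X k t \<omega> /\<^sub>R sqrt k - \<phi> t x))"
      proof eventually_elim
        fix \<omega>
        assume "bessel_path_D k (sqrt k *\<^sub>R x + y) (\<lambda>t. B t \<omega>) (\<lambda>t. X k t \<omega>)"
        then have "continuous_on {0..T} (\<lambda>t. X k t \<omega>)"
          by (auto simp: bessel_path_D_def intro: continuous_on_subset)
        then show "continuous_on {0..T} (\<lambda>t. norm (X k t \<omega> /\<^sub>R sqrt k - \<phi> t x))"
          by (intro continuous_intros \<phi>)
      qed
    qed
    moreover have "AE \<omega> in M. eventually (\<lambda>k. \<omega> \<notin> E k) at_top"
      using unif
    proof eventually_elim
      fix \<omega>
      assume "\<forall>T\<ge>0. uniform_limit {0..T} (\<lambda>k t. X k t \<omega> /\<^sub>R sqrt k) (\<lambda>t. \<phi> t x) at_top"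
      then have "\<forall>\<^sub>F k in at_top. \<forall>t\<in>{0..T}. dist (X k t \<omega> /\<^sub>R sqrt k) (\<phi> t x) < \<epsilon>"
        using that by (auto intro: uniform_limitD)
      then show "eventually (\<lambda>k. \<omega> \<notin> E k) at_top"
        by eventually_elim (force simp: E less_SUP_iff dist_norm)
    qed
    ultimately show ?thesis
      using tendsto_measure_completion_of_AE_eventually_not_in[of k0 E] by blast
  qed
  ultimately show ?thesis
    using unif by (auto simp: Let_def)
qed

end
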